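(* Let $c_1,c_2,c_3$ be positive integers, and let $(u_j)_{j\in\mathbb{Z}_{\geq0}}$ be the integer sequence defined by the initial conditions $u_0 = 0$, $u_1 = 0$, $u_2 = 1$, and $u_j = c_1 u_{j - 1} - c_2 u_{j - 2} + c_3 u_{j - 3}$ for $j>2$. Suppose there exists an integer $m>2$ with $u_m = u_{m+1} = 0$ and $u_{j} > 0$ for $j = 2,\ldots,m-1$. Then $m = 4$ or $m = 6$. *)

theory Defs
  imports Main
begin

end

theory Submission
  imports Defs Complex_Main
begin

text \<open>
  Let \<open>P = x^3 - c1 x^2 + c2 x - c3\<close> be the characteristic polynomial of the recurrence. Modulo
  \<open>P\<close>, the power \<open>x^m\<close> is a quadratic polynomial in \<open>x\<close> whose coefficients are built from
  \<open>u (m - 1)\<close>, \<open>u m\<close>, \<open>u (m + 1)\<close>; the two vanishing conditions say that \<open>x^m\<close> is congruent to a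
  constant \<open>\<lambda>\<close>. So every root of \<open>P\<close> has \<open>m\<close>-th power \<open>\<lambda>\<close> (\<open>lrec_root_power\<close>). By continuity,
  \<open>P\<close> has a real root \<open>\<rho> > 0\<close>. The companion matrix \<open>C\<close> satisfies \<open>C^m = \<lambda> I\<close>, and taking
  determinants gives \<open>c3^m = \<lambda>^3 = \<rho>^(3 m)\<close>, hence \<open>c3 = \<rho>^3\<close>; here the determinant enters
  through the Hankel determinants of the sequence (\<open>lrec_hankel_det\<close>). Now \<open>P(\<rho>) = 0\<close> becomes
  \<open>c2 = c1 \<rho>\<close>. Eliminating \<open>\<rho>\<close> gives \<open>c2^3 = c3 c1^3\<close>, so \<open>c1\<close> divides \<open>c2\<close> and \<open>\<rho>\<close> is an
  integer (\<open>lrec_coeffs_if_vanish\<close>).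

  The ratio \<open>k = c1 / \<rho>\<close> equals \<open>1 + 2 cos \<theta>\<close>, where the other two roots are
  \<open>\<rho> exp (i \<theta>)\<close> and its conjugate, and \<open>\<theta>\<close> is a rational multiple of \<open>\<pi>\<close>; the argument is the
  familiar one that \<open>2 cos \<theta>\<close> is then an integer as soon as it is rational. Concretely,
  \<open>u m / \<rho>^(m - 2)\<close> is a monic integer polynomial in \<open>k\<close>, and it vanishes, so the rational
  number \<open>k\<close> is an integer (\<open>lrec_ratio_integral\<close>). For \<open>k \<ge> 3\<close> the sequence never returns to zero
  (\<open>lrec_pos\<close>), which leaves \<open>k = 1\<close> and \<open>k = 2\<close>. In these cases the first zero after \<open>u 2 = 1\<close>
  is at index 4 and 6 respectively.
\<close>

section \<open>The fundamental solution of a third-order recurrence\<close>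

fun lrec :: "'a::comm_ring_1 \<Rightarrow> 'a \<Rightarrow> 'a \<Rightarrow> nat \<Rightarrow> 'a" where
  "lrec a b c 0 = 0"
| "lrec a b c (Suc 0) = 0"
| "lrec a b c (Suc (Suc 0)) = 1"
| "lrec a b c (Suc (Suc (Suc n))) =
     a * lrec a b c (Suc (Suc n)) - b * lrec a b c (Suc n) + c * lrec a b c n"

lemma lrec_unique:
  assumes "u 0 = 0" "u 1 = 0" "u 2 = 1"
    and "\<And>j. j > 2 \<Longrightarrow> u j = a * u (j - 1) - b * u (j - 2) + c * u (j - 3)"
  shows "u n = lrec a b c n"
  using assms
proof (induction a b c n rule: lrec.induct)
  case (4 a b c n)
  have "u (Suc (Suc (Suc n))) = a * u (Suc (Suc n)) - b * u (Suc n) + c * u n"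
    using "4.prems"(4)[of "Suc (Suc (Suc n))"] by simp
  then show ?case using "4.IH"[OF "4.prems"] by simp
qed (simp_all add: numeral_2_eq_2)

lemma of_int_lrec:
  "of_int (lrec a b c n) = lrec (of_int a) (of_int b) (of_int c :: 'a::comm_ring_1) n"
  by (induction a b c n rule: lrec.induct) simp_all

text \<open>Weighted homogeneity: scaling all roots of the characteristic polynomial by \<open>g\<close> scales the
  \<open>n\<close>-th term by \<open>g^(n - 2)\<close>. The factor \<open>g^2\<close> avoids the negative exponent.\<close>
lemma lrec_scale:
  "g\<^sup>2 * lrec (g * a) (g\<^sup>2 * b) (g ^ 3 * c) n = g ^ n * lrec a b c n"
proof (induction a b c n rule: lrec.induct)
  case (4 a b c n)
  let ?v = "lrec (g * a) (g\<^sup>2 * b) (g ^ 3 * c)"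
  have "g\<^sup>2 * ?v (Suc (Suc (Suc n))) =
      g * a * (g\<^sup>2 * ?v (Suc (Suc n))) - g\<^sup>2 * b * (g\<^sup>2 * ?v (Suc n)) + g ^ 3 * c * (g\<^sup>2 * ?v n)"
    by (simp add: algebra_simps)
  also have "\<dots> = g ^ Suc (Suc (Suc n)) * lrec a b c (Suc (Suc (Suc n)))"
    by (simp only: 4) (simp add: algebra_simps power2_eq_square power3_eq_cube)
  finally show ?case .
qed (simp_all add: power2_eq_square)

section \<open>Two consecutive zeros determine the shape of the coefficients\<close>

text \<open>This is the reduction of \<open>x^(n + 1)\<close> modulo the characteristic polynomial, evaluated at a
  root \<open>r\<close>.\<close>
lemma lrec_root_power:
  fixes r :: "'a::comm_ring_1"
  assumes "r ^ 3 = a * r\<^sup>2 - b * r + c"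
  shows "r ^ Suc n = lrec a b c (Suc n) * r\<^sup>2
    + (lrec a b c (Suc (Suc n)) - a * lrec a b c (Suc n)) * r + c * lrec a b c n"
proof (induction n)
  case (Suc n)
  let ?x = "lrec a b c n" and ?y = "lrec a b c (Suc n)" and ?z = "lrec a b c (Suc (Suc n))"
  have "r ^ Suc (Suc n) = r * (?y * r\<^sup>2 + (?z - a * ?y) * r + c * ?x)"
    using Suc by simp
  also have "\<dots> = ?y * r ^ 3 + (?z - a * ?y) * r\<^sup>2 + c * ?x * r"
    by (simp add: algebra_simps power2_eq_square power3_eq_cube)
  also have "\<dots> = ?z * r\<^sup>2 + (- b * ?y + c * ?x) * r + c * ?y"
    by (simp add: assms algebra_simps)
  finally show ?case by simp
qed simp

text \<open>Written as the Laplace expansion along the last column, which is the column that the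
  recurrence expresses through the preceding ones.\<close>
definition hankel_det :: "(nat \<Rightarrow> 'a::comm_ring_1) \<Rightarrow> nat \<Rightarrow> 'a" where
  "hankel_det u n =
     u (n + 2) * (u (n + 1) * u (n + 3) - u (n + 2) * u (n + 2))
   - u (n + 3) * (u n * u (n + 3) - u (n + 1) * u (n + 2))
   + u (n + 4) * (u n * u (n + 2) - u (n + 1) * u (n + 1))"

text \<open>Shifting the index multiplies the Hankel matrix by the companion matrix, whose determinant
  is \<open>c\<close>.\<close>
lemma hankel_det_step:
  assumes rec: "\<And>n. u (n + 3) = a * u (n + 2) - b * u (n + 1) + c * u n"
  shows "hankel_det u (Suc n) = c * hankel_det u n"
proof -
  let ?x0 = "u n" and ?x1 = "u (n + 1)" and ?x2 = "u (n + 2)"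
    and ?x3 = "u (n + 3)" and ?x4 = "u (n + 4)" and ?x5 = "u (n + 5)"
  have rec4: "?x4 = a * ?x3 - b * ?x2 + c * ?x1" and rec5: "?x5 = a * ?x4 - b * ?x3 + c * ?x2"
    using rec[of "n + 1"] rec[of "n + 2"] by (simp_all add: eval_nat_numeral)
  have "hankel_det u (Suc n) = ?x3 * (?x2 * ?x4 - ?x3 * ?x3)
      - ?x4 * (?x1 * ?x4 - ?x2 * ?x3) + ?x5 * (?x1 * ?x3 - ?x2 * ?x2)"
    by (simp add: hankel_det_def eval_nat_numeral)
  \<comment> \<open>Only the last column is rewritten; the minors stay as they are.\<close>
  also have "\<dots> = (a * ?x2 - b * ?x1 + c * ?x0) * (?x2 * ?x4 - ?x3 * ?x3)
      - (a * ?x3 - b * ?x2 + c * ?x1) * (?x1 * ?x4 - ?x2 * ?x3)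
      + (a * ?x4 - b * ?x3 + c * ?x2) * (?x1 * ?x3 - ?x2 * ?x2)"
    by (simp only: rec[symmetric] rec4[symmetric] rec5[symmetric])
  also have "\<dots> = c * hankel_det u n"
    by (simp add: hankel_det_def algebra_simps)
  finally show ?thesis .
qed

lemma lrec_hankel_det: "hankel_det (lrec a b c) n = - (c ^ n)"
proof (induction n)
  case 0
  then show ?case by (simp add: hankel_det_def eval_nat_numeral)
next
  case (Suc n)
  have "hankel_det (lrec a b c) (Suc n) = c * hankel_det (lrec a b c) n"
    by (rule hankel_det_step) (simp add: eval_nat_numeral)
  then show ?case using Suc by simp
qed

lemma cubic_pos_root:
  fixes a b c :: real
  assumes "a > 0" "b > 0" "c > 0"
  shows "\<exists>r > 0. r ^ 3 = a * r\<^sup>2 - b * r + c"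
proof -
  define f where "f x = x ^ 3 - a * x\<^sup>2 + b * x - c" for x
  \<comment> \<open>At \<open>a + c + 1\<close> the cubic term dominates \<open>a x^2\<close> with a margin of at least \<open>c\<close>.\<close>
  define M where "M = a + c + 1"
  have "M \<ge> 1" using assms by (simp add: M_def)
  have "c * 1 \<le> (c + 1) * M\<^sup>2"
    using assms \<open>M \<ge> 1\<close> by (intro mult_mono) auto
  moreover have "f M = (c + 1) * M\<^sup>2 + b * M - c"
    by (simp add: f_def M_def algebra_simps power2_eq_square power3_eq_cube)
  moreover have "b * M > 0" using assms \<open>M \<ge> 1\<close> by simp
  ultimately have "f M \<ge> 0" by linarith
  moreover have "f 0 \<le> 0" using assms by (simp add: f_def)
  moreover have "continuous_on {0..M} f"
    unfolding f_def by (intro continuous_intros)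
  ultimately obtain r where r: "0 \<le> r" "f r = 0"
    using IVT'[of f 0 0 M] \<open>M \<ge> 1\<close> by auto
  have "r \<noteq> 0" using r assms by (auto simp: f_def)
  then show ?thesis using r by (intro exI[of _ r]) (auto simp: f_def algebra_simps)
qed

text \<open>The integer \<open>r\<close> is the positive real root \<open>\<rho>\<close>. It equals \<open>c2 / c1\<close>, so it is integral because
  its cube is the integer \<open>c3\<close>.\<close>
lemma lrec_coeffs_if_vanish:
  fixes c1 c2 c3 :: int
  assumes pos: "c1 > 0" "c2 > 0" "c3 > 0"
    and zero: "lrec c1 c2 c3 (Suc n) = 0" "lrec c1 c2 c3 (Suc (Suc n)) = 0"
  obtains r where "r > 0" "c2 = c1 * r" "c3 = r ^ 3"
proof -
  define w where "w = c3 * lrec c1 c2 c3 n"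
  obtain \<rho> :: real where \<rho>: "\<rho> > 0" "\<rho> ^ 3 = c1 * \<rho>\<^sup>2 - c2 * \<rho> + c3"
    using cubic_pos_root[of "of_int c1" "of_int c2" "of_int c3"] pos by auto
  have "\<rho> ^ Suc n = of_int w"
    unfolding w_def using lrec_root_power[OF \<rho>(2), of n] zero
    by (simp only: of_int_lrec[symmetric] of_int_mult) simp
  have u3: "lrec c1 c2 c3 (Suc (Suc (Suc n))) = w"
    using zero by (simp add: w_def)
  \<comment> \<open>The Hankel matrix at the zeros is triangular with \<open>w\<close> on the antidiagonal.\<close>
  have "- (c3 ^ Suc n) = hankel_det (lrec c1 c2 c3) (Suc n)"
    by (rule lrec_hankel_det[symmetric])
  also have "\<dots> = - (w ^ 3)"
    unfolding hankel_det_def using zero u3 by (simp add: power3_eq_cube)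
  finally have "c3 ^ Suc n = w ^ 3" by simp
  then have "real_of_int c3 ^ Suc n = of_int w ^ 3"
    by (metis of_int_power)
  also have "\<dots> = (\<rho> ^ 3) ^ Suc n"
    by (simp only: \<open>\<rho> ^ Suc n = of_int w\<close>[symmetric] power_mult[symmetric] mult.commute)
  finally have c3: "real_of_int c3 = \<rho> ^ 3"
    by (rule power_inject_base) (use pos \<rho>(1) in simp_all)
  then have "\<rho> * of_int c2 = \<rho> * (of_int c1 * \<rho>)"
    using \<rho>(2) by (simp add: power2_eq_square algebra_simps)
  then have c2: "real_of_int c2 = of_int c1 * \<rho>" using \<rho>(1) by simp
  then have "real_of_int (c2 ^ 3) = of_int (c1 ^ 3 * c3)"
    by (simp add: c3 power_mult_distrib)
  then have cube: "c2 ^ 3 = c1 ^ 3 * c3" by (simp only: of_int_eq_iff)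
  then have "c1 ^ 3 dvd c2 ^ 3" by simp
  then have "c1 dvd c2" by simp
  then obtain r where r: "c2 = c1 * r" by blast
  show thesis
  proof
    show "r > 0" using r pos by (simp add: zero_less_mult_iff)
    show "c2 = c1 * r" by fact
    show "c3 = r ^ 3" using cube pos by (simp add: r power_mult_distrib)
  qed
qed

section \<open>Integrality and size of the ratio\<close>

lemma lrec_cong_power:
  fixes a b :: int
  shows "b dvd lrec a (a * b) (b ^ 3) (Suc (Suc n)) - a ^ n"
proof (induction n)
  case (Suc n)
  let ?v = "lrec a (a * b) (b ^ 3)"
  have "?v (Suc (Suc (Suc n))) - a ^ Suc n
      = a * (?v (Suc (Suc n)) - a ^ n) + b * (b\<^sup>2 * ?v n - a * ?v (Suc n))"
    by (simp add: algebra_simps power2_eq_square power3_eq_cube)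
  with Suc show ?case by (metis dvd_add dvd_mult dvd_triv_left)
qed simp

text \<open>The rational root theorem for the monic polynomial satisfied by \<open>c / r\<close>: with the fraction
  in lowest terms, the vanishing of a term forces the denominator to divide a power of the
  numerator.\<close>
lemma lrec_ratio_integral:
  fixes c r :: int
  assumes "r > 0" and zero: "lrec c (c * r) (r ^ 3) (Suc (Suc n)) = 0"
  shows "r dvd c"
proof -
  define g where "g = gcd c r"
  have "g > 0" using assms by (simp add: g_def)
  obtain a b where ab: "c = g * a" "r = g * b" "coprime a b"
    using gcd_coprime_exists[of c r] \<open>g > 0\<close> unfolding g_def by (metis less_irrefl mult.commute)
  have "g\<^sup>2 * lrec c (c * r) (r ^ 3) (Suc (Suc n)) = g ^ Suc (Suc n) * lrec a (a * b) (b ^ 3) (Suc (Suc n))"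
    using lrec_scale[of g a "a * b" "b ^ 3"]
    by (simp add: ab power_mult_distrib power2_eq_square mult_ac)
  then have "lrec a (a * b) (b ^ 3) (Suc (Suc n)) = 0"
    using zero \<open>g > 0\<close> by simp
  then have "b dvd a ^ n" using lrec_cong_power[of b a n] by simp
  moreover have "coprime b (a ^ n)" using ab(3) by (simp add: coprime_commute)
  ultimately have "is_unit b" by (metis coprime_absorb_left)
  then have "b dvd a" by (rule unit_imp_dvd)
  then have "g * b dvd g * a" by (intro mult_dvd_mono) auto
  then show ?thesis by (simp only: ab)
qed

text \<open>Here the characteristic polynomial is \<open>(x - 1) (x^2 - (k - 1) x + 1)\<close>, and its second factor
  has positive real roots. So the differences of the sequence obey a second-order recurrence
  whose solution increases.\<close>
lemma lrec_pos:
  fixes k :: int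
  assumes "k \<ge> 3"
  shows "lrec k k 1 (Suc (Suc n)) > 0"
proof -
  let ?w = "lrec k k 1"
  have "?w (Suc n) \<ge> 0 \<and> ?w (Suc (Suc n)) > ?w (Suc n)
      \<and> ?w (Suc (Suc n)) - ?w (Suc n) > ?w (Suc n) - ?w n"
  proof (induction n)
    case (Suc n)
    have "(k - 3) * (?w (Suc (Suc n)) - ?w (Suc n)) \<ge> 0"
      using Suc assms by simp
    moreover have "?w (Suc (Suc (Suc n))) = k * ?w (Suc (Suc n)) - k * ?w (Suc n) + ?w n"
      by simp
    ultimately show ?case using Suc by (simp only: algebra_simps) linarith
  qed simp
  then show ?thesis by linarith
qed

section \<open>The position of the double zero\<close>

theorem lemma5p2:
  fixes c1 c2 c3 :: int and u :: "nat \<Rightarrow> int" and m :: nat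
  assumes "c1 > 0" and "c2 > 0" and "c3 > 0"
    and "u 0 = 0" and "u 1 = 0" and "u 2 = 1"
    and "\<And>j. j > 2 \<Longrightarrow> u j = c1 * u (j - 1) - c2 * u (j - 2) + c3 * u (j - 3)"
    and "m > 2" and "u m = 0" and "u (m + 1) = 0"
    and "\<And>j. j \<in> {2..m - 1} \<Longrightarrow> u j > 0"
  shows "m = 4 \<or> m = 6"
proof -
  have u: "u = lrec c1 c2 c3"
    using lrec_unique[of u c1 c2 c3] assms(4-7) by blast
  obtain n where m: "m = Suc (Suc n)"
    using \<open>m > 2\<close> by (metis Suc_lessE numeral_2_eq_2)
  obtain r where r: "r > 0" "c2 = c1 * r" "c3 = r ^ 3"
    using lrec_coeffs_if_vanish[of c1 c2 c3 "Suc n"] assms(1-3,9,10) by (auto simp: u m)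
  then have "r dvd c1"
    using lrec_ratio_integral[of r c1 n] \<open>u m = 0\<close> by (simp add: u m)
  then obtain k where k: "c1 = r * k" by blast
  have "k > 0" using k \<open>c1 > 0\<close> r(1) by (simp add: zero_less_mult_iff)
  have scale: "r\<^sup>2 * u j = r ^ j * lrec k k 1 j" for j
    using lrec_scale[of r k k 1 j] by (simp add: u k r(2,3) power2_eq_square mult_ac)
  have zero_iff: "u j = 0 \<longleftrightarrow> lrec k k 1 j = 0" for j
    using scale[of j] r(1) by (metis mult_eq_0_iff power_not_zero less_irrefl)
  have first: "m \<le> j" if "lrec k k 1 j = 0" "j \<ge> 2" for j
  proof (rule ccontr)
    assume "\<not> m \<le> j"
    then have "u j > 0" using that by (intro assms(11)) auto
    then show False using that zero_iff[of j] by simp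
  qed
  have vanish: "lrec k k 1 m = 0" using zero_iff[of m] \<open>u m = 0\<close> by simp
  then have "k < 3" using lrec_pos[of k n] by (cases "k < 3") (auto simp: m)
  with \<open>k > 0\<close> consider "k = 1" | "k = 2" by linarith
  then show ?thesis
  proof cases
    case 1
    have "m \<le> 4" by (rule first) (simp_all add: 1 eval_nat_numeral)
    moreover have "m \<noteq> 3" using vanish by (auto simp: 1 eval_nat_numeral)
    ultimately show ?thesis using \<open>m > 2\<close> by linarith
  next
    case 2
    have "m \<le> 6" by (rule first) (simp_all add: 2 eval_nat_numeral)
    moreover have "m \<noteq> 3" "m \<noteq> 4" "m \<noteq> 5" using vanish by (auto simp: 2 eval_nat_numeral)
    ultimately show ?thesis using \<open>m > 2\<close> by linarith
  qed
qed

end
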